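(* Let $n\ge 3$ be odd, $q=(n-1)/2$, and place $n$ equally spaced points on a circle, labelled cyclically by $0,1,\dots,n-1\in\mathbb{Z}_n$; to a pair $\{x,y\}$ associate the chord $[x,y]$ joining the points labelled $x$ and $y$. Call the segment from the point $0$ to the center of the circle the $0$-radius. Consider the properties of a set $C$ of chords: (a) no two chords have the same length; (b) no two chords are parallel; (c) no two chords share a common endpoint; (d) the perpendicular bisector of no chord passes through the point $0$; (e) the point $0$ is not an endpoint of any chord; (f) no chord crosses the $0$-radius. If $S$ is a strong Skolem starter in $\mathbb{Z}_n$, then the set of chords $\{[x,y]:\{x,y\}\in S\}$ satisfies (a)–(f). Conversely, any set of $q$ chords between these labelled points satisfying (a)–(f) yields (via its pairs of endpoints) a strong Skolem starter in $\mathbb{Z}_n$.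
   Context: A starter in $\mathbb{Z}_n$ ($n$ odd) is a partition of $\mathbb{Z}_n\setminus\{0\}$ into $q=(n-1)/2$ pairs $\{s_i,t_i\}$ such that the elements $\pm(s_i-t_i)$ are exactly the non-zero elements of $\mathbb{Z}_n$. It is strong if the sums $s_i+t_i$ are non-zero and pairwise distinct. Ordering the non-zero residues as $1<2<\dots<2q$, a starter is Skolem if it can be written as $\{\{s_i,t_i\}\}_{i=1}^q$ with $t_i-s_i\equiv i\pmod n$ and $t_i>s_i$ for $1\le i\le q$. A strong Skolem starter is a starter that is both strong and Skolem. *)

theory Defs
  imports
    "HOL-Analysis.Analysis"
    "HOL-Library.Disjoint_Sets"
    "HOL-Number_Theory.Cong"
begin

(* Elements of Z_n are represented by their canonical representatives 0, ..., n - 1, so the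
   order 1 < 2 < ... < n - 1 used by Skolem starters is the order of int, while sums and
   differences are taken modulo n.  An unordered pair is a set of cardinality 2. *)

definition Zn :: "nat \<Rightarrow> int set" where
  "Zn n = {0..<int n}"

(* Both orders of each pair contribute a difference, which accounts for the two signs. *)
definition starter :: "nat \<Rightarrow> int set set \<Rightarrow> bool" where
  "starter n S \<longleftrightarrow>
     partition_on (Zn n - {0}) S \<and>
     card S = (n - 1) div 2 \<and>
     (\<forall>P\<in>S. card P = 2) \<and>
     {(s - t) mod int n | s t. s \<noteq> t \<and> {s, t} \<in> S} = Zn n - {0}"

definition pair_sum :: "nat \<Rightarrow> int set \<Rightarrow> int" where
  "pair_sum n P = (\<Sum>x\<in>P. x) mod int n"

definition strong_starter :: "nat \<Rightarrow> int set set \<Rightarrow> bool" where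
  "strong_starter n S \<longleftrightarrow>
     starter n S \<and> (\<forall>P\<in>S. pair_sum n P \<noteq> 0) \<and> inj_on (pair_sum n) S"

definition skolem_starter :: "nat \<Rightarrow> int set set \<Rightarrow> bool" where
  "skolem_starter n S \<longleftrightarrow>
     starter n S \<and>
     (\<exists>s t :: nat \<Rightarrow> int.
        S = (\<lambda>i. {s i, t i}) ` {1..(n - 1) div 2} \<and>
        (\<forall>i\<in>{1..(n - 1) div 2}. [t i - s i = int i] (mod int n) \<and> t i > s i))"

definition strong_skolem_starter :: "nat \<Rightarrow> int set set \<Rightarrow> bool" where
  "strong_skolem_starter n S \<longleftrightarrow> strong_starter n S \<and> skolem_starter n S"

(* The Euclidean plane is the type complex.  The circle has centre c and radius r; the position
   of the point labelled 0 and the sense (clockwise or not) of the labelling are arbitrary. *)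
definition cyclic_labelling :: "nat \<Rightarrow> complex \<Rightarrow> real \<Rightarrow> (int \<Rightarrow> complex) \<Rightarrow> bool" where
  "cyclic_labelling n c r p \<longleftrightarrow>
     r > 0 \<and>
     (\<exists>\<theta> \<sigma>. \<sigma> \<in> {1, -1} \<and>
        (\<forall>k\<in>Zn n. p k = c + of_real r * cis (\<theta> + \<sigma> * (2 * pi * of_int k / real n))))"

(* A chord is a closed segment, as a set of points.  A closed segment determines its two
   endpoints up to order (closed_segment_eq), and the notions below are symmetric in the
   endpoints, so the existential quantifiers only name them. *)

definition is_endpoint :: "complex \<Rightarrow> complex set \<Rightarrow> bool" where
  "is_endpoint z s \<longleftrightarrow> (\<exists>w. s = closed_segment z w)"

definition same_length :: "complex set \<Rightarrow> complex set \<Rightarrow> bool" where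
  "same_length s t \<longleftrightarrow>
     (\<exists>a b u v. s = closed_segment a b \<and> t = closed_segment u v \<and> dist a b = dist u v)"

definition parallel_segments :: "complex set \<Rightarrow> complex set \<Rightarrow> bool" where
  "parallel_segments s t \<longleftrightarrow>
     (\<exists>a b u v. s = closed_segment a b \<and> t = closed_segment u v \<and>
        collinear {0, b - a, v - u})"

definition share_endpoint :: "complex set \<Rightarrow> complex set \<Rightarrow> bool" where
  "share_endpoint s t \<longleftrightarrow> (\<exists>z. is_endpoint z s \<and> is_endpoint z t)"

definition perpendicular_bisector :: "complex set \<Rightarrow> complex set" where
  "perpendicular_bisector s =
     {z. \<exists>a b. s = closed_segment a b \<and> (z - midpoint a b) \<bullet> (b - a) = 0}"

definition segments_cross :: "complex set \<Rightarrow> complex set \<Rightarrow> bool" where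
  "segments_cross s t \<longleftrightarrow>
     (\<exists>a b u v. s = closed_segment a b \<and> t = closed_segment u v \<and>
        open_segment a b \<inter> open_segment u v \<noteq> {})"

definition chords :: "nat \<Rightarrow> (int \<Rightarrow> complex) \<Rightarrow> complex set set" where
  "chords n p = {closed_segment (p x) (p y) | x y. x \<in> Zn n \<and> y \<in> Zn n \<and> x \<noteq> y}"

definition chords_of_pairs :: "(int \<Rightarrow> complex) \<Rightarrow> int set set \<Rightarrow> complex set set" where
  "chords_of_pairs p S = {closed_segment (p x) (p y) | x y. {x, y} \<in> S}"

definition endpoint_pairs :: "nat \<Rightarrow> (int \<Rightarrow> complex) \<Rightarrow> complex set set \<Rightarrow> int set set" where
  "endpoint_pairs n p C =
     {{x, y} | x y. x \<in> Zn n \<and> y \<in> Zn n \<and> closed_segment (p x) (p y) \<in> C}"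

(* The conjuncts are the properties (a)-(f), in this order, for a circle with centre c on which
   z is the point labelled 0; closed_segment z c is the 0-radius. *)
definition chord_properties :: "complex \<Rightarrow> complex \<Rightarrow> complex set set \<Rightarrow> bool" where
  "chord_properties c z C \<longleftrightarrow>
     pairwise (\<lambda>s t. \<not> same_length s t) C \<and>
     pairwise (\<lambda>s t. \<not> parallel_segments s t) C \<and>
     pairwise (\<lambda>s t. \<not> share_endpoint s t) C \<and>
     (\<forall>s\<in>C. z \<notin> perpendicular_bisector s) \<and>
     (\<forall>s\<in>C. \<not> is_endpoint z s) \<and>
     (\<forall>s\<in>C. \<not> segments_cross s (closed_segment z c))"

end

theory Submission
  imports Defs
begin

text \<open>For residues \<open>x < y\<close> the chord from \<open>x\<close> to \<open>y\<close> has length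
  \<open>2 r sin (\<pi> (y - x) / n)\<close> and its direction is determined modulo \<open>\<pi>\<close> by
  \<open>\<pi> (x + y) / n\<close>.  Hence equal lengths mean equal differences up to sign, parallel chords mean
  equal sums, and the bisector passes through \<open>0\<close> exactly when the sum is zero.  The chord
  crosses the \<open>0\<close>-radius exactly when \<open>y - x > n / 2\<close>, so avoiding it is the Skolem
  condition.  For the converse, (c) and (e) make \<open>q\<close> disjoint pairs inside a set of size
  \<open>2 q\<close>, and (a) and (f) make \<open>q\<close> distinct differences inside \<open>{1..q}\<close>, so
  counting gives equality in both cases.\<close>

section \<open>Segment predicates read off from given endpoints\<close>

text \<open>The quantified endpoints can only be the given ones in either order, and
  \<open>dist\<close> is symmetric.\<close>

lemma same_length_closed_segment:
  "same_length (closed_segment a b) (closed_segment u v) \<longleftrightarrow> dist a b = dist u v"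
  by (auto simp: same_length_def doubleton_eq_iff dist_commute)

text \<open>Exchanging the endpoints of a segment negates its direction vector, and collinearity
  with the origin does not see that sign.\<close>

lemma parallel_closed_segment:
  "parallel_segments (closed_segment a b) (closed_segment u v) \<longleftrightarrow> collinear {0, b - a, v - u}"
proof -
  have minus: "collinear {0, - x, y} \<longleftrightarrow> collinear {0, x, y}"
    "collinear {0, x, - y} \<longleftrightarrow> collinear {0, x, y}" for x y :: complex
    using collinear_scaleR_iff[of "-1" x 1 y] collinear_scaleR_iff[of 1 x "-1" y] by auto
  have swap: "collinear {0, x - y, z} \<longleftrightarrow> collinear {0, y - x, z}"
    "collinear {0, z, x - y} \<longleftrightarrow> collinear {0, z, y - x}" for x y z :: complex
    using minus[of "y - x" z] minus[of z "y - x"] by simp_all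
  show ?thesis
    by (auto simp: parallel_segments_def doubleton_eq_iff swap)
qed

lemma is_endpoint_closed_segment: "is_endpoint z (closed_segment a b) \<longleftrightarrow> z = a \<or> z = b"
  by (auto simp: is_endpoint_def doubleton_eq_iff)

lemma segments_cross_closed_segment:
  "segments_cross (closed_segment a b) (closed_segment u v) \<longleftrightarrow>
     open_segment a b \<inter> open_segment u v \<noteq> {}"
  unfolding segments_cross_def closed_segment_eq doubleton_eq_iff
  by (metis open_segment_commute)

text \<open>The inner product in the definition is half the difference of the squared distances from
  \<open>z\<close> to the two endpoints.\<close>

lemma perpendicular_bisector_closed_segment:
  "z \<in> perpendicular_bisector (closed_segment a b) \<longleftrightarrow> dist z a = dist z b"
proof -
  have inner: "(z - midpoint u v) \<bullet> (v - u) = ((dist z u)\<^sup>2 - (dist z v)\<^sup>2) / 2" for u v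
    by (simp add: dist_norm power2_norm_eq_inner midpoint_def algebra_simps inner_commute)
  have "(z - midpoint u v) \<bullet> (v - u) = 0 \<longleftrightarrow> dist z u = dist z v" for u v
    by (simp add: inner power2_eq_iff_nonneg)
  then show ?thesis
    by (auto simp: perpendicular_bisector_def doubleton_eq_iff)
qed

section \<open>Trigonometry of points on a circle\<close>

lemma sin_pi_frac_eq_0_iff:
  assumes "n > 0"
  shows "sin (pi * real_of_int k / real n) = 0 \<longleftrightarrow> int n dvd k"
proof -
  have "pi * real_of_int k / real n = of_int i * pi \<longleftrightarrow> k = int n * i" for i
  proof -
    have "pi * real_of_int k / real n = of_int i * pi \<longleftrightarrow> real_of_int k = real n * of_int i"
      using assms by (auto simp: field_simps)
    also have "\<dots> \<longleftrightarrow> k = int n * i"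
      by (metis of_int_eq_iff of_int_mult of_int_of_nat_eq)
    finally show ?thesis .
  qed
  then show ?thesis
    by (simp add: sin_zero_iff_int2 dvd_def)
qed

text \<open>The difference of the cosines factors into the sines of \<open>pi * (k + l) / n\<close>
  and \<open>pi * (l - k) / n\<close>; each of them vanishes exactly under one of the two
  divisibilities.\<close>

lemma cos_2pi_frac_eq_iff:
  assumes "n > 0"
  shows "cos (2 * pi * real_of_int k / real n) = cos (2 * pi * real_of_int l / real n) \<longleftrightarrow>
    int n dvd k - l \<or> int n dvd k + l"
proof -
  have "cos (2 * pi * real_of_int k / real n) - cos (2 * pi * real_of_int l / real n) =
      2 * sin (pi * real_of_int (k + l) / real n) * sin (pi * real_of_int (l - k) / real n)"
    by (simp add: cos_diff_cos add_divide_distrib diff_divide_distrib algebra_simps)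
  then have "cos (2 * pi * real_of_int k / real n) = cos (2 * pi * real_of_int l / real n) \<longleftrightarrow>
      int n dvd k + l \<or> int n dvd l - k"
    using sin_pi_frac_eq_0_iff[OF assms, of "k + l"] sin_pi_frac_eq_0_iff[OF assms, of "l - k"]
    by auto
  then show ?thesis
    by (metis dvd_diff_commute)
qed

lemma Zn_dvd_diff_iff:
  assumes "x \<in> Zn n" "y \<in> Zn n"
  shows "int n dvd x - y \<longleftrightarrow> x = y"
  using assms by (simp add: Zn_def mod_eq_dvd_iff[symmetric])

text \<open>This is the law of cosines for two radii; the squared form avoids the absolute value of
  a half-angle sine.\<close>

lemma dist_cis_squared:
  "(dist (c + of_real r * cis \<alpha>) (c + of_real r * cis \<beta>))\<^sup>2 = 2 * r\<^sup>2 * (1 - cos (\<alpha> - \<beta>))"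
proof -
  have "(dist (c + of_real r * cis \<alpha>) (c + of_real r * cis \<beta>))\<^sup>2 =
      r\<^sup>2 * ((cos \<alpha> - cos \<beta>)\<^sup>2 + (sin \<alpha> - sin \<beta>)\<^sup>2)"
    by (simp add: dist_norm cmod_power2 power_mult_distrib distrib_left flip: right_diff_distrib)
  also have "\<dots> = r\<^sup>2 * ((cos \<alpha>)\<^sup>2 + (sin \<alpha>)\<^sup>2 + ((cos \<beta>)\<^sup>2 + (sin \<beta>)\<^sup>2) - 2 * cos (\<alpha> - \<beta>))"
    by (simp add: cos_diff power2_diff algebra_simps)
  finally show ?thesis
    by (simp add: algebra_simps)
qed

text \<open>The purpose is to separate length and direction: the real factor carries the signed
  length, and the remaining unit vector depends only on the sum of the angles.\<close>

lemma cis_diff_eq: "cis \<beta> - cis \<alpha> = of_real (2 * sin ((\<beta> - \<alpha>) / 2)) * (\<i> * cis ((\<alpha> + \<beta>) / 2))"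
  using sin_minus[of "(\<beta> - \<alpha>) / 2"]
  by (simp add: complex_eq_iff cos_diff_cos sin_diff_sin add.commute[of \<beta>] minus_divide_left
      del: sin_minus)

text \<open>Collinearity with 0 says that the quotient is real; here the quotient is
  \<open>cis (\<beta> - \<alpha>)\<close>, whose imaginary part is the sine.\<close>

lemma collinear_cis_iff: "collinear {0, cis \<alpha>, cis \<beta>} \<longleftrightarrow> sin (\<beta> - \<alpha>) = 0"
  by (simp add: collinear_iff_Reals cis_divide complex_is_Real_iff)

text \<open>With \<open>\<alpha>\<close> or \<open>\<beta>\<close> eliminated, the two equations become
  \<open>u sin \<beta> = (1 - t) sin (\<beta> - \<alpha>)\<close> and \<open>- u sin \<alpha> = t sin (\<beta> - \<alpha>)\<close>, which decides
  on which side of \<open>\<pi>\<close> the two angles lie.\<close>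

lemma arc_crosses_radius_iff:
  assumes "0 < \<alpha>" "\<alpha> < \<beta>" "\<beta> < 2 * pi" "\<beta> - \<alpha> \<noteq> pi"
  shows "(\<exists>t u. 0 < t \<and> t < 1 \<and> 0 < u \<and> u < 1 \<and>
      (1 - t) * cos \<alpha> + t * cos \<beta> = u \<and> (1 - t) * sin \<alpha> + t * sin \<beta> = 0) \<longleftrightarrow> \<beta> - \<alpha> > pi"
proof
  assume "\<exists>t u. 0 < t \<and> t < 1 \<and> 0 < u \<and> u < 1 \<and>
      (1 - t) * cos \<alpha> + t * cos \<beta> = u \<and> (1 - t) * sin \<alpha> + t * sin \<beta> = 0"
  then obtain t u where t: "0 < t" "t < 1" and u: "0 < u"
    and re: "(1 - t) * cos \<alpha> + t * cos \<beta> = u" and im: "(1 - t) * sin \<alpha> + t * sin \<beta> = 0"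
    by blast
  have b: "u * sin \<beta> = (1 - t) * sin (\<beta> - \<alpha>)" and a: "- (u * sin \<alpha>) = t * sin (\<beta> - \<alpha>)"
    unfolding sin_diff re[symmetric] using im by algebra+
  show "\<beta> - \<alpha> > pi"
  proof (rule ccontr)
    assume "\<not> \<beta> - \<alpha> > pi"
    with assms have "sin (\<beta> - \<alpha>) > 0"
      by (intro sin_gt_zero) auto
    with t have "(1 - t) * sin (\<beta> - \<alpha>) > 0" "t * sin (\<beta> - \<alpha>) > 0"
      by simp_all
    with a b have "u * sin \<beta> > 0" "u * sin \<alpha> < 0"
      by linarith+
    with u have "sin \<beta> > 0" "sin \<alpha> < 0"
      by (auto simp: zero_less_mult_iff mult_less_0_iff)
    then have "\<beta> < pi" "\<alpha> > pi"
      using assms sin_ge_zero[of \<alpha>] sin_le_zero[of \<beta>] by (auto simp: not_le[symmetric])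
    with assms show False by simp
  qed
next
  assume gt: "\<beta> - \<alpha> > pi"
  have a: "sin \<alpha> > 0" using assms gt by (intro sin_gt_zero) auto
  have b: "sin \<beta> < 0" using assms gt by (intro sin_lt_zero) auto
  have d: "sin (\<beta> - \<alpha>) < 0" using assms gt by (intro sin_lt_zero) auto
  \<comment> \<open>This is the weight at which the segment between the two points meets the real
    axis; the signs \<open>a\<close> and \<open>b\<close> put it strictly between 0 and 1.\<close>
  define t where "t = sin \<alpha> / (sin \<alpha> - sin \<beta>)"
  define u where "u = (1 - t) * cos \<alpha> + t * cos \<beta>"
  have t: "0 < t" "t < 1" and im: "(1 - t) * sin \<alpha> + t * sin \<beta> = 0"
    using a b by (simp_all add: t_def field_simps)
  have "- (u * sin \<alpha>) = t * sin (\<beta> - \<alpha>)"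
    unfolding u_def sin_diff using im by algebra
  moreover have "t * sin (\<beta> - \<alpha>) < 0"
    using t d by (simp add: mult_pos_neg)
  ultimately have "u * sin \<alpha> > 0"
    by linarith
  then have "u > 0" using a by (simp add: zero_less_mult_iff)
  \<comment> \<open>\<open>u\<close> is a weighted mean of two cosines, so it is below 1 once one of
    them is; \<alpha> qualifies because it lies strictly between 0 and \<open>pi\<close>.\<close>
  have "cos \<alpha> < 1"
    using cos_monotone_0_pi[of 0 \<alpha>] assms gt by simp
  then have "(1 - t) * cos \<alpha> + t * cos \<beta> < (1 - t) * 1 + t * 1"
    using t by (intro add_less_le_mono mult_strict_left_mono mult_left_mono) auto
  then have "u < 1" by (simp add: u_def)
  with t im \<open>u > 0\<close> show "\<exists>t u. 0 < t \<and> t < 1 \<and> 0 < u \<and> u < 1 \<and>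
      (1 - t) * cos \<alpha> + t * cos \<beta> = u \<and> (1 - t) * sin \<alpha> + t * sin \<beta> = 0"
    unfolding u_def by blast
qed

section \<open>Chords of the labelled circle in terms of residues\<close>

text \<open>The witnesses from \<open>cyclic_labelling\<close> are fixed as parameters, so that
  positions are given by an explicit formula: \<theta> is the angle of the point 0 and \<sigma> the
  sense of the labelling.\<close>

locale labelled_circle =
  fixes n :: nat and c :: complex and r :: real and p :: "int \<Rightarrow> complex"
    and \<theta> \<sigma> :: real
  assumes n_ge_3: "n \<ge> 3" and odd_n: "odd n" and r_pos: "r > 0"
    and sigma: "\<sigma> \<in> {1, -1}"
    and p_eq: "k \<in> Zn n \<Longrightarrow> p k = c + of_real r * cis (\<theta> + \<sigma> * (2 * pi * of_int k / real n))"
begin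

text \<open>The squared lengths involve only the cosine of the angle between two radii; cosine is
  even, so \<sigma> disappears.\<close>

lemma dist_eq_iff:
  assumes "x \<in> Zn n" "y \<in> Zn n" "u \<in> Zn n" "v \<in> Zn n"
  shows "dist (p x) (p y) = dist (p u) (p v) \<longleftrightarrow>
    int n dvd (x - y) - (u - v) \<or> int n dvd (x - y) + (u - v)"
proof -
  have sq: "(dist (p x) (p y))\<^sup>2 = 2 * r\<^sup>2 * (1 - cos (2 * pi * of_int (x - y) / real n))"
    if "x \<in> Zn n" "y \<in> Zn n" for x y
  proof -
    have "cos (\<theta> + \<sigma> * (2 * pi * of_int x / real n) - (\<theta> + \<sigma> * (2 * pi * of_int y / real n))) =
        cos (\<sigma> * (2 * pi * of_int (x - y) / real n))"
      by (simp add: algebra_simps diff_divide_distrib)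
    also have "\<dots> = cos (2 * pi * of_int (x - y) / real n)"
      using sigma by (auto simp del: of_int_diff)
    finally show ?thesis
      using that by (simp only: p_eq dist_cis_squared)
  qed
  have "dist (p x) (p y) = dist (p u) (p v) \<longleftrightarrow> (dist (p x) (p y))\<^sup>2 = (dist (p u) (p v))\<^sup>2"
    by (simp add: power2_eq_iff_nonneg)
  also have "\<dots> \<longleftrightarrow> cos (2 * pi * of_int (x - y) / real n) = cos (2 * pi * of_int (u - v) / real n)"
    using r_pos assms by (simp add: sq del: of_int_diff)
  also have "\<dots> \<longleftrightarrow> int n dvd (x - y) - (u - v) \<or> int n dvd (x - y) + (u - v)"
    using n_ge_3 by (intro cos_2pi_frac_eq_iff) simp
  finally show ?thesis .
qed

lemma inj_on_p: "inj_on p (Zn n)"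
proof (rule inj_onI)
  fix x y assume xy: "x \<in> Zn n" "y \<in> Zn n" "p x = p y"
  then have "int n dvd x - y"
    using dist_eq_iff[of x y x x] by auto
  with xy show "x = y"
    by (simp add: Zn_dvd_diff_iff)
qed

text \<open>The angle between the directions of two chords is, modulo \<open>pi\<close>, \<sigma>
  times \<open>pi / n\<close> times the difference of their label sums, and its sine decides
  parallelism.\<close>

lemma parallel_iff:
  assumes "x \<in> Zn n" "y \<in> Zn n" "u \<in> Zn n" "v \<in> Zn n" "x \<noteq> y" "u \<noteq> v"
  shows "parallel_segments (closed_segment (p x) (p y)) (closed_segment (p u) (p v)) \<longleftrightarrow>
    int n dvd (x + y) - (u + v)"
proof -
  \<comment> \<open>\<open>h\<close> is the mean of the angles of the two endpoints; by
    \<open>cis_diff_eq\<close> the chord is perpendicular to that direction.\<close>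
  define h where "h x y = \<theta> + \<sigma> * (pi * of_int (x + y) / real n)" for x y
  have chord: "\<exists>k. k \<noteq> 0 \<and> p y - p x = k *\<^sub>R (\<i> * cis (h x y))"
    if "x \<in> Zn n" "y \<in> Zn n" "x \<noteq> y" for x y
  proof -
    define A where "A = \<theta> + \<sigma> * (2 * pi * of_int x / real n)"
    define B where "B = \<theta> + \<sigma> * (2 * pi * of_int y / real n)"
    have "(A + B) / 2 = h x y"
      by (simp add: A_def B_def h_def add_divide_distrib algebra_simps)
    moreover have "p y - p x = of_real r * (cis B - cis A)"
      using that by (simp add: p_eq A_def B_def algebra_simps)
    ultimately have eq: "p y - p x = (r * (2 * sin ((B - A) / 2))) *\<^sub>R (\<i> * cis (h x y))"
      unfolding cis_diff_eq by (simp add: scaleR_conv_of_real)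
    have "p y - p x \<noteq> 0"
      using inj_on_p that by (auto dest: inj_onD)
    with eq show ?thesis
      by (metis scaleR_zero_left)
  qed
  obtain k l where kl: "k \<noteq> 0" "l \<noteq> 0" "p y - p x = k *\<^sub>R (\<i> * cis (h x y))"
      "p v - p u = l *\<^sub>R (\<i> * cis (h u v))"
    using chord assms by meson
  \<comment> \<open>The quarter turn common to both vectors cancels in their quotient.\<close>
  have rot: "collinear {0, \<i> * cis a, \<i> * cis b} \<longleftrightarrow> collinear {0, cis a, cis b}" for a b
    by (simp add: collinear_iff_Reals)
  have "h u v - h x y = \<sigma> * (pi * of_int ((u + v) - (x + y)) / real n)"
    by (simp add: h_def algebra_simps add_divide_distrib diff_divide_distrib)
  then have "sin (h u v - h x y) = 0 \<longleftrightarrow> sin (pi * of_int ((u + v) - (x + y)) / real n) = 0"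
    using sigma by (auto simp del: of_int_diff of_int_add)
  also have "\<dots> \<longleftrightarrow> int n dvd (u + v) - (x + y)"
    using n_ge_3 by (intro sin_pi_frac_eq_0_iff) simp
  also have "\<dots> \<longleftrightarrow> int n dvd (x + y) - (u + v)"
    by (rule dvd_diff_commute)
  finally show ?thesis
    using kl by (simp add: parallel_closed_segment collinear_scaleR_iff rot collinear_cis_iff)
qed

text \<open>Comparing the distances of both endpoints from \<open>p 0\<close> leaves two
  divisibilities, and that of \<open>y - x\<close> is impossible for distinct residues.\<close>

lemma bisector_iff:
  assumes "x \<in> Zn n" "y \<in> Zn n" "x \<noteq> y"
  shows "p 0 \<in> perpendicular_bisector (closed_segment (p x) (p y)) \<longleftrightarrow> int n dvd x + y"
proof -
  have "0 \<in> Zn n"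
    using n_ge_3 by (simp add: Zn_def)
  then have "p 0 \<in> perpendicular_bisector (closed_segment (p x) (p y)) \<longleftrightarrow>
      int n dvd y - x \<or> int n dvd x + y"
    using assms dist_eq_iff[of 0 x 0 y] dvd_minus_iff[of "int n" "x + y"]
    by (simp add: perpendicular_bisector_closed_segment add.commute)
  moreover have "\<not> int n dvd y - x"
    using assms by (simp add: Zn_dvd_diff_iff)
  ultimately show ?thesis by simp
qed

text \<open>Measured from the center in units of the vector to \<open>p 0\<close>, the 0-radius
  becomes the real segment from 0 to 1, which is the situation of
  \<open>arc_crosses_radius_iff\<close>.\<close>

lemma crosses_iff:
  assumes "0 < x" "x < y" "y < int n"
  shows "segments_cross (closed_segment (p x) (p y)) (closed_segment (p 0) c) \<longleftrightarrow>
    2 * (y - x) > int n"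
proof -
  define a where "a = 2 * pi * real_of_int x / real n"
  define b where "b = 2 * pi * real_of_int y / real n"
  define w where "w = of_real r * cis \<theta>"
  have w: "w \<noteq> 0" using r_pos by (simp add: w_def)
  have "0 \<in> Zn n" "x \<in> Zn n" "y \<in> Zn n" using assms by (auto simp: Zn_def)
  then have p: "p 0 = c + w" "p x = c + w * cis (\<sigma> * a)" "p y = c + w * cis (\<sigma> * b)"
    by (auto simp: p_eq w_def a_def b_def simp flip: cis_mult)
  have "inj_on p (Zn n)" by (rule inj_on_p)
  then have ne: "p x \<noteq> p y" using \<open>x \<in> Zn n\<close> \<open>y \<in> Zn n\<close> assms by (auto dest: inj_onD)
  have "segments_cross (closed_segment (p x) (p y)) (closed_segment (p 0) c) \<longleftrightarrow>
      (\<exists>t u. 0 < t \<and> t < 1 \<and> 0 < u \<and> u < 1 \<and>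
        (1 - t) *\<^sub>R p x + t *\<^sub>R p y = (1 - u) *\<^sub>R c + u *\<^sub>R p 0)"
    unfolding segments_cross_closed_segment open_segment_commute[of "p 0"]
    using ne w p(1) by (auto simp: set_eq_iff in_segment)
  also have "\<dots> \<longleftrightarrow> (\<exists>t u. 0 < t \<and> t < 1 \<and> 0 < u \<and> u < 1 \<and>
        (1 - t) * cos a + t * cos b = u \<and> (1 - t) * sin a + t * sin b = 0)"
  proof -
    have "(1 - t) *\<^sub>R p x + t *\<^sub>R p y = (1 - u) *\<^sub>R c + u *\<^sub>R p 0 \<longleftrightarrow>
        (1 - t) * cos a + t * cos b = u \<and> (1 - t) * sin a + t * sin b = 0" for t u
    proof -
      have "(1 - t) *\<^sub>R p x + t *\<^sub>R p y - ((1 - u) *\<^sub>R c + u *\<^sub>R p 0) =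
          w * ((1 - t) *\<^sub>R cis (\<sigma> * a) + t *\<^sub>R cis (\<sigma> * b) - of_real u)"
        by (simp add: p scaleR_conv_of_real algebra_simps)
      then have "(1 - t) *\<^sub>R p x + t *\<^sub>R p y = (1 - u) *\<^sub>R c + u *\<^sub>R p 0 \<longleftrightarrow>
          (1 - t) *\<^sub>R cis (\<sigma> * a) + t *\<^sub>R cis (\<sigma> * b) = of_real u"
        using w by (metis eq_iff_diff_eq_0 mult_eq_0_iff)
      \<comment> \<open>For \<sigma> equal to -1 both points are reflected in the real axis, which
        only negates the second equation.\<close>
      also have "\<dots> \<longleftrightarrow> (1 - t) * cos a + t * cos b = u \<and> (1 - t) * sin a + t * sin b = 0"
        using sigma by (auto simp: complex_eq_iff)
      finally show ?thesis .
    qed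
    then show ?thesis by simp
  qed
  also have "\<dots> \<longleftrightarrow> b - a > pi"
  proof (rule arc_crosses_radius_iff)
    show "0 < a" "a < b" "b < 2 * pi"
      using assms n_ge_3 by (auto simp: a_def b_def field_simps)
    \<comment> \<open>A chord through the center would make \<open>n\<close> equal to
      \<open>2 * (y - x)\<close>, hence even.\<close>
    show "b - a \<noteq> pi"
    proof
      assume "b - a = pi"
      then have "pi * real_of_int (2 * (y - x)) = pi * real_of_int (int n)"
        using n_ge_3 by (simp add: a_def b_def field_simps)
      then have "real_of_int (2 * (y - x)) = real_of_int (int n)"
        by (metis mult_cancel_left pi_neq_zero)
      then have "2 * (y - x) = int n" by (simp only: of_int_eq_iff)
      with odd_n show False by presburger
    qed
  qed
  also have "b - a = pi * (2 * (real_of_int y - real_of_int x) / real n)"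
    by (simp add: a_def b_def diff_divide_distrib algebra_simps)
  also have "pi < \<dots> \<longleftrightarrow> real n < 2 * (real_of_int y - real_of_int x)"
    using n_ge_3 mult_less_cancel_left_pos[OF pi_gt_zero, of 1]
    by (simp add: less_divide_eq del: mult_less_cancel_left_pos)
  also have "\<dots> \<longleftrightarrow> real_of_int (int n) < real_of_int (2 * (y - x))"
    by simp
  also have "\<dots> \<longleftrightarrow> int n < 2 * (y - x)"
    by (simp only: of_int_less_iff)
  finally show ?thesis .
qed

end

section \<open>From strong Skolem starters to chord sets\<close>

text \<open>Both \<open>t i - s i\<close> and \<open>i\<close> lie strictly between 0 and
  \<open>n\<close>, so the congruence in the Skolem condition is an equality of integers.\<close>

lemma skolem_starterE:
  assumes "skolem_starter n S"
  obtains s t where "S = (\<lambda>i. {s i, t i}) ` {1..(n - 1) div 2}"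
    and "\<And>i. i \<in> {1..(n - 1) div 2} \<Longrightarrow> 0 < s i \<and> t i < int n \<and> t i - s i = int i"
proof -
  obtain s t where S: "S = (\<lambda>i. {s i, t i}) ` {1..(n - 1) div 2}"
    and st: "\<And>i. i \<in> {1..(n - 1) div 2} \<Longrightarrow> [t i - s i = int i] (mod int n) \<and> t i > s i"
    using assms by (auto simp: skolem_starter_def)
  have union: "\<Union>S = Zn n - {0}"
    using assms by (simp add: skolem_starter_def starter_def partition_on_def)
  have "0 < s i \<and> t i < int n \<and> t i - s i = int i" if i: "i \<in> {1..(n - 1) div 2}" for i
  proof -
    have "{s i, t i} \<subseteq> Zn n - {0}"
      unfolding union[symmetric] S using i by blast
    then have "0 < s i" "t i < int n"
      by (auto simp: Zn_def)
    moreover have "t i - s i = int i"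
      using st[OF i] i \<open>0 < s i\<close> \<open>t i < int n\<close>
        cong_less_imp_eq_int[of "t i - s i" "int n" "int i"] by auto
    ultimately show ?thesis by simp
  qed
  with S show thesis by (rule that)
qed

lemma pair_sum_doubleton: "x \<noteq> y \<Longrightarrow> pair_sum n {x, y} = (x + y) mod int n"
  by (simp add: pair_sum_def)

context labelled_circle
begin

lemma p_eq_iff: "x \<in> Zn n \<Longrightarrow> y \<in> Zn n \<Longrightarrow> p x = p y \<longleftrightarrow> x = y"
  using inj_on_p by (auto dest: inj_onD)

text \<open>With chords indexed by their difference \<open>i\<close>, (a) and (f) come from the
  Skolem form, (b) and (d) from the sums, (c) and (e) from the partition.\<close>

lemma chord_properties_of_starter:
  assumes S: "strong_skolem_starter n S"
  shows "chord_properties c (p 0) (chords_of_pairs p S)"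
proof -
  let ?I = "{1..(n - 1) div 2}"
  have strong: "strong_starter n S" and skolem: "skolem_starter n S"
    using S by (simp_all add: strong_skolem_starter_def)
  obtain s t where S_eq: "S = (\<lambda>i. {s i, t i}) ` ?I"
    and st: "\<And>i. i \<in> ?I \<Longrightarrow> 0 < s i \<and> t i < int n \<and> t i - s i = int i"
    by (rule skolem_starterE[OF skolem]) blast
  define ch where "ch i = closed_segment (p (s i)) (p (t i))" for i
  have zero: "0 \<in> Zn n" using n_ge_3 by (simp add: Zn_def)
  have Zn: "s i \<in> Zn n" "t i \<in> Zn n" "s i < t i" "2 * int i < int n" if "i \<in> ?I" for i
  proof -
    show "s i < t i" using st[OF that] that by simp
    then show "s i \<in> Zn n" "t i \<in> Zn n" using st[OF that] by (simp_all add: Zn_def)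
    have "i \<le> (n - 1) div 2" using that by simp
    then show "2 * int i < int n" using n_ge_3 by linarith
  qed
  have in_S: "{s i, t i} \<in> S" if "i \<in> ?I" for i
    using that S_eq by blast
  have chords: "chords_of_pairs p S = ch ` ?I"
  proof
    show "chords_of_pairs p S \<subseteq> ch ` ?I"
    proof
      fix z assume "z \<in> chords_of_pairs p S"
      then obtain x y i where "z = closed_segment (p x) (p y)" "i \<in> ?I" "{x, y} = {s i, t i}"
        unfolding chords_of_pairs_def S_eq by blast
      then show "z \<in> ch ` ?I"
        by (metis ch_def closed_segment_commute doubleton_eq_iff imageI)
    qed
    show "ch ` ?I \<subseteq> chords_of_pairs p S"
      unfolding chords_of_pairs_def ch_def using in_S by blast
  qed
  \<comment> \<open>Sums and disjointness recover a pair only as an unordered set, which still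
    determines the chord.\<close>
  have ch_cong: "ch i = ch j" if "{s i, t i} = {s j, t j}" for i j
    using that by (auto simp: ch_def doubleton_eq_iff closed_segment_commute)
  have length: "i = j" if ij: "i \<in> ?I" "j \<in> ?I" and same: "same_length (ch i) (ch j)" for i j
  proof -
    have diffs: "(s i - t i) - (s j - t j) = int j - int i"
      "(s i - t i) + (s j - t j) = - (int i + int j)"
      using st[OF ij(1)] st[OF ij(2)] by linarith+
    have "int n dvd int j - int i \<or> int n dvd - (int i + int j)"
      using same dist_eq_iff[OF Zn(1,2)[OF ij(1)] Zn(1,2)[OF ij(2)]]
      by (simp only: ch_def same_length_closed_segment diffs)
    \<comment> \<open>Both \<open>i\<close> and \<open>j\<close> are below \<open>n / 2\<close>, so
      their sum lies strictly between 0 and \<open>n\<close>.\<close>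
    moreover have "\<not> int n dvd - (int i + int j)"
      unfolding dvd_minus_iff
    proof (rule zdvd_not_zless)
      show "0 < int i + int j" using ij by simp
      show "int i + int j < int n" using Zn(4)[OF ij(1)] Zn(4)[OF ij(2)] by linarith
    qed
    moreover have "int j \<in> Zn n" "int i \<in> Zn n"
      using Zn(4)[OF ij(1)] Zn(4)[OF ij(2)] by (auto simp: Zn_def)
    ultimately show ?thesis by (simp add: Zn_dvd_diff_iff)
  qed
  have parallel: "ch i = ch j"
    if ij: "i \<in> ?I" "j \<in> ?I" and par: "parallel_segments (ch i) (ch j)" for i j
  proof (rule ch_cong)
    have "int n dvd (s i + t i) - (s j + t j)"
      using par Zn[OF ij(1)] Zn[OF ij(2)] by (simp add: ch_def parallel_iff)
    then have "pair_sum n {s i, t i} = pair_sum n {s j, t j}"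
      using Zn(3)[OF ij(1)] Zn(3)[OF ij(2)] by (simp add: pair_sum_doubleton mod_eq_dvd_iff)
    then show "{s i, t i} = {s j, t j}"
      using strong in_S ij by (auto simp: strong_starter_def dest: inj_onD)
  qed
  have endpoint: "ch i = ch j"
    if ij: "i \<in> ?I" "j \<in> ?I" and share: "share_endpoint (ch i) (ch j)" for i j
  proof (rule ch_cong)
    have "{s i, t i} \<inter> {s j, t j} \<noteq> {}"
      using share Zn[OF ij(1)] Zn[OF ij(2)]
      by (auto simp: ch_def share_endpoint_def is_endpoint_closed_segment p_eq_iff)
    moreover have "disjoint S"
      using strong by (simp add: strong_starter_def starter_def partition_on_def)
    ultimately show "{s i, t i} = {s j, t j}"
      using disjointD in_S[OF ij(1)] in_S[OF ij(2)] by blast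
  qed
  have bisector: "p 0 \<notin> perpendicular_bisector (ch i)" if i: "i \<in> ?I" for i
  proof -
    have "pair_sum n {s i, t i} \<noteq> 0"
      using strong in_S[OF i] by (simp add: strong_starter_def)
    then show ?thesis
      using Zn[OF i] by (simp add: ch_def bisector_iff pair_sum_doubleton dvd_eq_mod_eq_0)
  qed
  have zero_end: "\<not> is_endpoint (p 0) (ch i)" if i: "i \<in> ?I" for i
    using Zn[OF i] st[OF i] zero by (auto simp: ch_def is_endpoint_closed_segment p_eq_iff)
  have cross: "\<not> segments_cross (ch i) (closed_segment (p 0) c)" if i: "i \<in> ?I" for i
  proof -
    have "0 < s i" "s i < t i" "t i < int n" "t i - s i = int i"
      using Zn(3)[OF i] st[OF i] by simp_all
    moreover have "\<not> int n < 2 * int i"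
      using Zn(4)[OF i] by simp
    ultimately have "0 < s i" "s i < t i" "t i < int n" "\<not> int n < 2 * (t i - s i)"
      by simp_all
    then show ?thesis
      unfolding ch_def by (simp add: crosses_iff)
  qed
  show ?thesis
    unfolding chord_properties_def chords
  proof (intro conjI pairwiseI ballI)
    fix u v assume "u \<in> ch ` ?I" "v \<in> ch ` ?I" "u \<noteq> v"
    then obtain i j where ij: "i \<in> ?I" "j \<in> ?I" "u = ch i" "v = ch j" "ch i \<noteq> ch j"
      by (elim imageE) simp
    show "\<not> same_length u v"
      using length[OF ij(1,2)] ij(3-5) by (intro notI) simp
    show "\<not> parallel_segments u v"
      using parallel[OF ij(1,2)] ij(3-5) by (intro notI) simp
    show "\<not> share_endpoint u v"
      using endpoint[OF ij(1,2)] ij(3-5) by (intro notI) simp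
  next
    fix u assume "u \<in> ch ` ?I"
    then obtain i where i: "i \<in> ?I" "u = ch i" by (elim imageE)
    show "p 0 \<notin> perpendicular_bisector u" "\<not> is_endpoint (p 0) u"
      "\<not> segments_cross u (closed_segment (p 0) c)"
      unfolding i(2) by (rule bisector[OF i(1)] zero_end[OF i(1)] cross[OF i(1)])+
  qed
qed

section \<open>From chord sets to strong Skolem starters\<close>

lemma starter_of_chord_properties:
  assumes C: "C \<subseteq> chords n p" and card_C: "card C = (n - 1) div 2"
    and props: "chord_properties c (p 0) C"
  shows "strong_skolem_starter n (endpoint_pairs n p C)"
proof -
  let ?q = "(n - 1) div 2"
  define S where "S = endpoint_pairs n p C"
  have n_eq: "int n = 2 * int ?q + 1"
    using odd_n by (auto elim!: oddE)
  have zero: "0 \<in> Zn n" using n_ge_3 by (simp add: Zn_def)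
  \<comment> \<open>A normal form for the pairs: \<open>endpoint_pairs\<close> itself imposes
    neither an order nor distinctness, and the bound on the difference comes from (f).\<close>
  have S_obtain: "\<exists>x y. P = {x, y} \<and> 0 < x \<and> x < y \<and> y < int n \<and> 2 * (y - x) < int n \<and>
      closed_segment (p x) (p y) \<in> C" if P: "P \<in> S" for P
  proof -
    obtain x y where xy: "P = {x, y}" "x \<in> Zn n" "y \<in> Zn n" "closed_segment (p x) (p y) \<in> C"
      using P by (auto simp: S_def endpoint_pairs_def)
    then obtain u v where uv: "u \<in> Zn n" "v \<in> Zn n" "u \<noteq> v"
        "closed_segment (p x) (p y) = closed_segment (p u) (p v)"
      using C by (force simp: chords_def)
    \<comment> \<open>A degenerate segment would force equal endpoints, whereas chords in
      \<open>C\<close> join distinct labels.\<close>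
    have "x \<noteq> y"
    proof
      assume "x = y"
      with uv(4) have "{p x, p x} = {p u, p v}" by (simp only: closed_segment_eq)
      then have "p u = p v" by auto
      with uv(1-3) show False by (simp add: p_eq_iff)
    qed
    have "\<exists>x y. P = {x, y} \<and> x \<in> Zn n \<and> y \<in> Zn n \<and> x < y \<and> closed_segment (p x) (p y) \<in> C"
    proof (cases "x < y")
      case True
      with xy show ?thesis by blast
    next
      case False
      with \<open>x \<noteq> y\<close> have "y < x" by simp
      moreover have "P = {y, x}" "closed_segment (p y) (p x) \<in> C"
        using xy by (simp_all add: insert_commute closed_segment_commute)
      ultimately show ?thesis using xy(2,3) by blast
    qed
    then obtain x y where xy: "P = {x, y}" "x \<in> Zn n" "y \<in> Zn n" "x < y"
        "closed_segment (p x) (p y) \<in> C"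
      by blast
    have "\<not> is_endpoint (p 0) (closed_segment (p x) (p y))"
      using props xy(5) by (simp add: chord_properties_def)
    then have x: "0 < x" "y < int n"
      using xy zero by (auto simp: is_endpoint_closed_segment Zn_def order_le_less)
    have "\<not> segments_cross (closed_segment (p x) (p y)) (closed_segment (p 0) c)"
      using props xy(5) by (simp add: chord_properties_def)
    with x xy(4) have "\<not> int n < 2 * (y - x)"
      by (simp add: crosses_iff)
    \<comment> \<open>Parity of \<open>n\<close> turns the weak bound given by (f) into a strict
      one.\<close>
    moreover have "2 * (y - x) \<noteq> int n"
      using odd_n by presburger
    ultimately have "2 * (y - x) < int n"
      by simp
    with x xy show ?thesis by blast
  qed
  \<comment> \<open>The convex hull makes the chord a function of the unordered pair, so that
    \<open>S\<close> and \<open>C\<close> can be compared by a bijection.\<close>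
  define f where "f P = convex hull (p ` P)" for P
  have f_pair: "f {x, y} = closed_segment (p x) (p y)" for x y
    by (simp add: f_def segment_convex_hull)
  have f_C: "f P \<in> C" if "P \<in> S" for P
    using S_obtain[OF that] by (auto simp: f_pair)
  have "inj_on f S"
  proof (rule inj_onI)
    fix P Q assume PQ: "P \<in> S" "Q \<in> S" "f P = f Q"
    obtain x y where xy: "P = {x, y}" "0 < x" "x < y" "y < int n"
      using S_obtain[OF PQ(1)] by blast
    obtain u v where uv: "Q = {u, v}" "0 < u" "u < v" "v < int n"
      using S_obtain[OF PQ(2)] by blast
    have "p ` P = p ` Q"
      using PQ(3) unfolding xy uv f_pair by simp
    moreover have "P \<subseteq> Zn n" "Q \<subseteq> Zn n"
      using xy uv by (auto simp: Zn_def)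
    ultimately show "P = Q"
      using inj_on_p by (simp add: inj_on_image_eq_iff)
  qed
  moreover have "f ` S = C"
  proof
    show "f ` S \<subseteq> C" using f_C by blast
    show "C \<subseteq> f ` S"
    proof
      fix s assume s: "s \<in> C"
      then obtain x y where xy: "s = closed_segment (p x) (p y)" "x \<in> Zn n" "y \<in> Zn n"
        using C by (auto simp: chords_def)
      then have "{x, y} \<in> S"
        using s by (auto simp: S_def endpoint_pairs_def)
      then have "f {x, y} \<in> f ` S" by (rule imageI)
      with xy show "s \<in> f ` S" by (simp add: f_pair)
    qed
  qed
  ultimately have card_S: "card S = ?q"
    using card_C card_image[of f S] by simp
  \<comment> \<open>Positive cardinality rules out an infinite \<open>S\<close>, whose
    \<open>card\<close> would be 0.\<close>
  have "?q > 0" using n_ge_3 by auto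
  with card_S have fin_S: "finite S"
    by (metis card.infinite less_irrefl)
  have distinct: "\<not> same_length (f P) (f Q)" "\<not> parallel_segments (f P) (f Q)"
    "\<not> share_endpoint (f P) (f Q)" if "P \<in> S" "Q \<in> S" "P \<noteq> Q" for P Q
  proof -
    have "f P \<noteq> f Q" using \<open>inj_on f S\<close> that by (auto dest: inj_onD)
    then show "\<not> same_length (f P) (f Q)" "\<not> parallel_segments (f P) (f Q)"
      "\<not> share_endpoint (f P) (f Q)"
      using props f_C[OF that(1)] f_C[OF that(2)] by (auto simp: chord_properties_def pairwise_def)
  qed
  have disj: "disjoint S"
  proof (rule disjointI)
    fix P Q assume PQ: "P \<in> S" "Q \<in> S" "P \<noteq> Q"
    obtain x y u v where xy: "P = {x, y}" "Q = {u, v}"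
      using S_obtain[OF PQ(1)] S_obtain[OF PQ(2)] by blast
    show "P \<inter> Q = {}"
      using distinct(3)[OF PQ] unfolding xy f_pair share_endpoint_def is_endpoint_closed_segment
      by auto
  qed
  have card2: "card P = 2" if "P \<in> S" for P
    using S_obtain[OF that] by auto
  have sub: "\<Union>S \<subseteq> Zn n - {0}"
  proof
    fix z assume "z \<in> \<Union>S"
    then obtain P where "P \<in> S" "z \<in> P" by blast
    then show "z \<in> Zn n - {0}"
      using S_obtain[OF \<open>P \<in> S\<close>] by (auto simp: Zn_def)
  qed
  have union: "\<Union>S = Zn n - {0}"
  proof (rule card_subset_eq)
    show "finite (Zn n - {0})" by (simp add: Zn_def)
    have "card (\<Union>S) = sum card S"
      using disj card2 by (intro card_Union_disjoint)
        (simp_all add: disjoint_def pairwise_def disjnt_def card_ge_0_finite)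
    also have "\<dots> = 2 * ?q" using card2 card_S by simp
    also have "\<dots> = card (Zn n - {0})"
      using n_eq zero by (simp add: Zn_def)
    finally show "card (\<Union>S) = card (Zn n - {0})" .
  qed (rule sub)
  have part: "partition_on (Zn n - {0}) S"
    using union disj card2 by (force simp: partition_on_def)
  \<comment> \<open>\<open>Max\<close> minus \<open>Min\<close> is the difference of larger and
    smaller element without choosing an order on the pair.\<close>
  define d where "d P = Max P - Min P" for P :: "int set"
  have d_pair: "d {x, y} = y - x" if "x < y" for x y
    using that by (simp add: d_def)
  have "inj_on d S"
  proof (rule inj_onI, rule ccontr)
    fix P Q assume PQ: "P \<in> S" "Q \<in> S" "d P = d Q" "P \<noteq> Q"
    obtain x y where xy: "P = {x, y}" "0 < x" "x < y" "y < int n"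
      using S_obtain[OF PQ(1)] by blast
    obtain u v where uv: "Q = {u, v}" "0 < u" "u < v" "v < int n"
      using S_obtain[OF PQ(2)] by blast
    have "x - y = u - v"
      using PQ(3) xy uv by (simp add: d_pair)
    then have "dist (p x) (p y) = dist (p u) (p v)"
      using xy uv by (subst dist_eq_iff) (auto simp: Zn_def)
    then show False
      using distinct(1)[OF PQ(1,2,4)] xy uv by (simp add: f_pair same_length_closed_segment)
  qed
  \<comment> \<open>As \<open>n\<close> is \<open>2 * ?q + 1\<close>, a difference below
    \<open>n / 2\<close> is at most \<open>?q\<close>.\<close>
  moreover have "d ` S \<subseteq> int ` {1..?q}"
  proof
    fix k assume "k \<in> d ` S"
    then obtain P where "P \<in> S" "k = d P" by blast
    then have "1 \<le> k" "k \<le> int ?q"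
      using S_obtain[OF \<open>P \<in> S\<close>] n_eq by (auto simp: d_pair)
    then show "k \<in> int ` {1..?q}"
      by (simp add: image_int_atLeastAtMost)
  qed
  \<comment> \<open>An injective image of \<open>?q\<close> pairs inside a set of \<open>?q\<close>
    numbers is all of it, so every difference occurs.\<close>
  ultimately have d_image: "d ` S = int ` {1..?q}"
    using card_S by (intro card_subset_eq) (simp_all add: card_image)
  have diff: "\<exists>x y. {x, y} \<in> S \<and> x < y \<and> y - x = k" if "0 < k" "k \<le> int ?q" for k
  proof -
    have "k \<in> d ` S"
      using that by (simp add: d_image image_int_atLeastAtMost)
    then obtain P where P: "P \<in> S" "d P = k"
      by auto
    obtain x y where xy: "P = {x, y}" "x < y"
      using S_obtain[OF P(1)] by blast
    then have "{x, y} \<in> S \<and> x < y \<and> y - x = k"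
      using P by (simp add: d_pair)
    then show ?thesis by blast
  qed
  have "{(s - t) mod int n | s t. s \<noteq> t \<and> {s, t} \<in> S} = Zn n - {0}" (is "?D = _")
  proof
    show "?D \<subseteq> Zn n - {0}"
    proof clarify
      fix s t assume st: "s \<noteq> t" "{s, t} \<in> S"
      then have "s \<in> Zn n" "t \<in> Zn n" using sub by blast+
      with st(1) have "(s - t) mod int n \<noteq> 0"
        using Zn_dvd_diff_iff[of s n t] by (simp add: dvd_eq_mod_eq_0)
      then show "(s - t) mod int n \<in> Zn n - {0}"
        using n_ge_3 by (simp add: Zn_def)
    qed
    show "Zn n - {0} \<subseteq> ?D"
    proof
      fix k assume "k \<in> Zn n - {0}"
      then have k: "0 < k" "k < int n" by (auto simp: Zn_def)
      show "k \<in> ?D"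
      \<comment> \<open>Residues up to \<open>?q\<close> arise as larger minus smaller element; for
        the others \<open>n - k\<close> is at most \<open>?q\<close>, and the reversed difference is
        \<open>k\<close> modulo \<open>n\<close>.\<close>
      proof (cases "k \<le> int ?q")
        case True
        then obtain x y where "{x, y} \<in> S" "x < y" "y - x = k"
          using diff[of k] k by blast
        then have "{y, x} \<in> S \<and> y \<noteq> x \<and> k = (y - x) mod int n"
          using k by (simp add: insert_commute)
        then show ?thesis by blast
      next
        case False
        then have "0 < int n - k" "int n - k \<le> int ?q"
          using k n_eq by linarith+
        then obtain x y where xy: "{x, y} \<in> S" "x < y" "y - x = int n - k"
          using diff by blast
        then have "x - y = k - int n" by simp
        then have "(x - y) mod int n = k"
          using k by (metis minus_mod_self2 mod_pos_pos_trivial order_less_imp_le)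
        with xy show ?thesis by blast
      qed
    qed
  qed
  with part card_S card2 have starter: "starter n S"
    by (simp add: starter_def)
  moreover have "pair_sum n P \<noteq> 0" if P: "P \<in> S" for P
  proof -
    obtain x y where xy: "P = {x, y}" "0 < x" "x < y" "y < int n" "closed_segment (p x) (p y) \<in> C"
      using S_obtain[OF P] by blast
    have "p 0 \<notin> perpendicular_bisector (closed_segment (p x) (p y))"
      using props xy(5) by (simp add: chord_properties_def)
    then show ?thesis
      using xy by (simp add: bisector_iff Zn_def pair_sum_doubleton dvd_eq_mod_eq_0)
  qed
  moreover have "inj_on (pair_sum n) S"
  proof (rule inj_onI, rule ccontr)
    fix P Q assume PQ: "P \<in> S" "Q \<in> S" "pair_sum n P = pair_sum n Q" "P \<noteq> Q"
    obtain x y where xy: "P = {x, y}" "0 < x" "x < y" "y < int n"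
      using S_obtain[OF PQ(1)] by blast
    obtain u v where uv: "Q = {u, v}" "0 < u" "u < v" "v < int n"
      using S_obtain[OF PQ(2)] by blast
    have "int n dvd (x + y) - (u + v)"
      using PQ(3) xy uv by (simp add: pair_sum_doubleton mod_eq_dvd_iff)
    then show False
      using distinct(2)[OF PQ(1,2,4)] xy uv by (simp add: f_pair parallel_iff Zn_def)
  qed
  moreover have "skolem_starter n S"
  proof -
    have "\<forall>i\<in>{1..?q}. \<exists>x y. {x, y} \<in> S \<and> x < y \<and> y - x = int i"
      using diff by simp
    then obtain s t where st: "\<And>i. i \<in> {1..?q} \<Longrightarrow> {s i, t i} \<in> S \<and> s i < t i \<and> t i - s i = int i"
      by metis
    \<comment> \<open>The chosen pairs exhaust \<open>S\<close>: a pair of \<open>S\<close> and the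
      chosen one with the same difference coincide by injectivity of \<open>d\<close>.\<close>
    have "S \<subseteq> (\<lambda>i. {s i, t i}) ` {1..?q}"
    proof
      fix P assume P: "P \<in> S"
      then have "d P \<in> int ` {1..?q}"
        unfolding d_image[symmetric] by blast
      then obtain i where i: "i \<in> {1..?q}" "d P = int i"
        by blast
      with st[OF i(1)] have "d {s i, t i} = d P"
        by (simp add: d_pair)
      with \<open>inj_on d S\<close> P st[OF i(1)] have "{s i, t i} = P"
        by (auto dest: inj_onD)
      with i(1) show "P \<in> (\<lambda>i. {s i, t i}) ` {1..?q}"
        by blast
    qed
    then have "S = (\<lambda>i. {s i, t i}) ` {1..?q}"
      using st by blast
    moreover have "\<forall>i\<in>{1..?q}. [t i - s i = int i] (mod int n) \<and> t i > s i"
      using st by simp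
    ultimately show ?thesis
      unfolding skolem_starter_def using starter by blast
  qed
  ultimately show ?thesis
    by (simp add: strong_skolem_starter_def strong_starter_def S_def)
qed

end

theorem theorem3:
  fixes n :: nat and c :: complex and r :: real and p :: "int \<Rightarrow> complex"
  assumes "n \<ge> 3" and "odd n"
    and "cyclic_labelling n c r p"
  shows "(\<forall>S. strong_skolem_starter n S \<longrightarrow> chord_properties c (p 0) (chords_of_pairs p S)) \<and>
    (\<forall>C. C \<subseteq> chords n p \<and> card C = (n - 1) div 2 \<and> chord_properties c (p 0) C \<longrightarrow>
       strong_skolem_starter n (endpoint_pairs n p C))"
proof -
  obtain \<theta> \<sigma> where "labelled_circle n c r p \<theta> \<sigma>"
    using assms unfolding cyclic_labelling_def labelled_circle_def by blast
  then interpret labelled_circle n c r p \<theta> \<sigma> .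
  show ?thesis
    using chord_properties_of_starter starter_of_chord_properties by blast
qed

end
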